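(* Let $r\ge2$ and let $0<\alpha_1<\alpha_2<\cdots<\alpha_r$ be real numbers with $\alpha_1/\alpha_2$ irrational. Color each lattice point $(x_1,\ldots,x_r)\in\mathbb{Z}^r$ white if $x_1+\cdots+x_r$ is even and black if it is odd. Then there exists $c>0$ such that, among the lattice points $(x_1,\ldots,x_r)\in\mathbb{Z}_{\ge0}^r$ with $\alpha_1x_1+\cdots+\alpha_rx_r\le c$ (the lattice points of the simplex bounded by the hyperplane $\sum\alpha_ix_i=c$ and the coordinate hyperplanes), the number of black points is greater than the number of white points. *)

theory Defs
  imports Complex_Main "HOL-Library.FuncSet"
begin

text \<open>
  A point of \<open>\<int>\<^sup>r\<close> is an integer-valued function on the index set \<open>{1..r}\<close>; it is
  extensional (undefined outside the index set), so that distinct functions are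
  distinct points and counting points is counting functions.
\<close>

definition lattice_points :: "nat \<Rightarrow> (nat \<Rightarrow> int) set" where
  "lattice_points r = {1..r} \<rightarrow>\<^sub>E UNIV"

definition white :: "nat \<Rightarrow> (nat \<Rightarrow> int) \<Rightarrow> bool" where
  "white r x \<longleftrightarrow> even (\<Sum>i = 1..r. x i)"

definition black :: "nat \<Rightarrow> (nat \<Rightarrow> int) \<Rightarrow> bool" where
  "black r x \<longleftrightarrow> odd (\<Sum>i = 1..r. x i)"

definition simplex_points :: "nat \<Rightarrow> (nat \<Rightarrow> real) \<Rightarrow> real \<Rightarrow> (nat \<Rightarrow> int) set" where
  "simplex_points r \<alpha> c =
     {x \<in> lattice_points r. (\<forall>i\<in>{1..r}. 0 \<le> x i) \<and> (\<Sum>i = 1..r. \<alpha> i * real_of_int (x i)) \<le> c}"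

text \<open>The simplex contains only finitely many lattice points, so \<open>card\<close> does count them.\<close>

lemma finite_simplex_points:
  assumes "\<And>i. i \<in> {1..r} \<Longrightarrow> 0 < \<alpha> i"
  shows "finite (simplex_points r \<alpha> c)"
proof (rule finite_subset)
  show "simplex_points r \<alpha> c \<subseteq> (\<Pi>\<^sub>E i\<in>{1..r}. {0..\<lfloor>c / \<alpha> i\<rfloor>})"
  proof
    fix x assume x: "x \<in> simplex_points r \<alpha> c"
    have "x i \<in> {0..\<lfloor>c / \<alpha> i\<rfloor>}" if i: "i \<in> {1..r}" for i
    proof -
      have "\<alpha> i * real_of_int (x i) \<le> (\<Sum>j = 1..r. \<alpha> j * real_of_int (x j))"
        using x i
        by (intro member_le_sum)
           (auto simp: simplex_points_def intro!: mult_nonneg_nonneg less_imp_le[OF assms])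
      also have "\<dots> \<le> c"
        using x by (simp add: simplex_points_def)
      finally have "real_of_int (x i) \<le> c / \<alpha> i"
        using assms[OF i] by (simp add: field_simps)
      then show ?thesis
        using x i by (simp add: simplex_points_def le_floor_iff)
    qed
    then show "x \<in> (\<Pi>\<^sub>E i\<in>{1..r}. {0..\<lfloor>c / \<alpha> i\<rfloor>})"
      using x by (auto simp: simplex_points_def lattice_points_def PiE_iff)
  qed
  show "finite (\<Pi>\<^sub>E i\<in>{1..r}. {0..\<lfloor>c / \<alpha> i\<rfloor>})"
    by (intro finite_PiE) auto
qed

end

theory Submission
  imports Defs "HOL-Analysis.Kronecker_Approximation_Theorem"
begin

text \<open>
  Let \<open>F\<^sub>I(c)\<close> be the number of white minus the number of black points of the simplex with
  coordinates indexed by \<open>I\<close>. Splitting off the points with \<open>x\<^sub>i = 0\<close> and shifting the others by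
  one gives \<open>F\<^sub>I(c) + F\<^sub>I(c - \<alpha>\<^sub>i) = F\<^bsub>I - {i}\<^esub>(c)\<close>. Hence a negative value of \<open>F\<^bsub>I - {i}\<^esub>\<close> forces one
  of \<open>F\<^sub>I\<close>, and it suffices to treat \<open>I = {1, 2}\<close>. If \<open>F = F\<^bsub>{1,2}\<^esub>\<close> were nonnegative,
  then \<open>F\<close> would vanish at \<open>d\<close> and at \<open>d - \<alpha>\<^sub>2\<close> whenever \<open>\<lfloor>d / \<alpha>\<^sub>1\<rfloor>\<close> is odd, because
  \<open>F\<^bsub>{1}\<^esub>(d) = 0\<close>. Kronecker's theorem yields a \<open>k\<close> such that for \<open>c = 2k\<alpha>\<^sub>2\<close> both
  \<open>\<lfloor>c / \<alpha>\<^sub>1\<rfloor>\<close> and \<open>\<lfloor>(c - \<alpha>\<^sub>1 + \<alpha>\<^sub>2) / \<alpha>\<^sub>1\<rfloor>\<close> are odd, so \<open>F(c) = F(c - \<alpha>\<^sub>1) = 0\<close>, in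
  contradiction to \<open>F(c) + F(c - \<alpha>\<^sub>1) = F\<^bsub>{2}\<^esub>(c) = 1\<close>.
\<close>

text \<open>Arbitrary index sets, unlike in \<open>simplex_points\<close>, allow a single coordinate
  to be deleted.\<close>

definition simplex_on :: "'a set \<Rightarrow> ('a \<Rightarrow> real) \<Rightarrow> real \<Rightarrow> ('a \<Rightarrow> int) set" where
  "simplex_on I \<alpha> c =
     {x \<in> I \<rightarrow>\<^sub>E UNIV. (\<forall>i\<in>I. 0 \<le> x i) \<and> (\<Sum>i\<in>I. \<alpha> i * real_of_int (x i)) \<le> c}"

definition colour_sign :: "'a set \<Rightarrow> ('a \<Rightarrow> int) \<Rightarrow> int" where
  "colour_sign I x = (if even (\<Sum>i\<in>I. x i) then 1 else - 1)"

definition white_excess :: "'a set \<Rightarrow> ('a \<Rightarrow> real) \<Rightarrow> real \<Rightarrow> int" where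
  "white_excess I \<alpha> c = (\<Sum>x\<in>simplex_on I \<alpha> c. colour_sign I x)"

lemma finite_simplex_on:
  assumes fin: "finite I" and pos: "\<And>i. i \<in> I \<Longrightarrow> 0 < \<alpha> i"
  shows "finite (simplex_on I \<alpha> c)"
proof (rule finite_subset)
  show "simplex_on I \<alpha> c \<subseteq> (\<Pi>\<^sub>E i\<in>I. {0..\<lfloor>c / \<alpha> i\<rfloor>})"
  proof
    fix x assume x: "x \<in> simplex_on I \<alpha> c"
    have "x i \<in> {0..\<lfloor>c / \<alpha> i\<rfloor>}" if i: "i \<in> I" for i
    proof -
      have "\<alpha> i * real_of_int (x i) \<le> (\<Sum>j\<in>I. \<alpha> j * real_of_int (x j))"
        using x i fin
        by (intro member_le_sum)
           (auto simp: simplex_on_def intro!: mult_nonneg_nonneg less_imp_le[OF pos])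
      also have "\<dots> \<le> c"
        using x by (simp add: simplex_on_def)
      finally show ?thesis
        using x i pos[OF i] by (simp add: simplex_on_def le_floor_iff field_simps)
    qed
    then show "x \<in> (\<Pi>\<^sub>E i\<in>I. {0..\<lfloor>c / \<alpha> i\<rfloor>})"
      using x by (auto simp: simplex_on_def PiE_iff)
  qed
  show "finite (\<Pi>\<^sub>E i\<in>I. {0..\<lfloor>c / \<alpha> i\<rfloor>})"
    using fin by (intro finite_PiE) auto
qed

lemma simplex_on_neg:
  assumes "\<And>i. i \<in> I \<Longrightarrow> 0 < \<alpha> i" and "c < 0"
  shows "simplex_on I \<alpha> c = {}"
proof -
  have "0 \<le> (\<Sum>i\<in>I. \<alpha> i * real_of_int (x i))" if "\<forall>i\<in>I. 0 \<le> x i" for x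
    using that assms(1) by (intro sum_nonneg mult_nonneg_nonneg) (auto intro: less_imp_le)
  then show ?thesis
    using \<open>c < 0\<close> by (force simp: simplex_on_def)
qed

lemma white_excess_recursion:
  fixes \<alpha> :: "'a \<Rightarrow> real"
  assumes fin: "finite I" and pos: "\<And>j. j \<in> I \<Longrightarrow> 0 < \<alpha> j" and i: "i \<in> I"
  shows "white_excess I \<alpha> c + white_excess I \<alpha> (c - \<alpha> i) = white_excess (I - {i}) \<alpha> c"
proof -
  let ?S = "simplex_on I \<alpha> c"
  let ?A = "{x \<in> ?S. x i = 0}" and ?B = "{x \<in> ?S. x i \<noteq> 0}"
  have weight: "(\<Sum>j\<in>I. \<alpha> j * real_of_int (x j)) =
      \<alpha> i * real_of_int (x i) + (\<Sum>j\<in>I - {i}. \<alpha> j * real_of_int (x j))"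
    and total: "(\<Sum>j\<in>I. x j) = x i + (\<Sum>j\<in>I - {i}. x j)" for x :: "'a \<Rightarrow> int"
    using fin i by (simp_all add: sum.remove)
  have weight_upd: "(\<Sum>j\<in>I - {i}. \<alpha> j * real_of_int (if j = i then v else x j)) =
      (\<Sum>j\<in>I - {i}. \<alpha> j * real_of_int (x j))"
    and total_upd: "(\<Sum>j\<in>I - {i}. if j = i then v else x j) = (\<Sum>j\<in>I - {i}. x j)"
    for x :: "'a \<Rightarrow> int" and v
    by (intro sum.cong; simp)+
  note sums = weight total weight_upd total_upd
  have "white_excess I \<alpha> c = (\<Sum>x\<in>?A \<union> ?B. colour_sign I x)"
    unfolding white_excess_def by (intro sum.cong) auto
  also have "\<dots> = (\<Sum>x\<in>?A. colour_sign I x) + (\<Sum>x\<in>?B. colour_sign I x)"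
    using finite_simplex_on[OF fin pos, where c = c] by (intro sum.union_disjoint) auto
  also have "(\<Sum>x\<in>?A. colour_sign I x) = white_excess (I - {i}) \<alpha> c"
    unfolding white_excess_def
  \<comment> \<open>Points are extensional, so a deleted coordinate becomes \<open>undefined\<close>
    and a restored one becomes 0.\<close>
  proof (rule sum.reindex_bij_witness[where j = "\<lambda>x. x(i := undefined)" and i = "\<lambda>x. x(i := 0)"])
    fix x assume x: "x \<in> simplex_on (I - {i}) \<alpha> c"
    then show "x(i := 0) \<in> ?A" "(x(i := 0))(i := undefined) = x"
      using i by (auto simp: simplex_on_def sums PiE_iff extensional_def)
  next
    fix x assume x: "x \<in> ?A"
    then show "x(i := undefined) \<in> simplex_on (I - {i}) \<alpha> c"
      "(x(i := undefined))(i := 0) = x"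
      "colour_sign (I - {i}) (x(i := undefined)) = colour_sign I x"
      using i by (auto simp: simplex_on_def colour_sign_def sums PiE_iff extensional_def)
  qed
  \<comment> \<open>Lowering coordinate \<open>i\<close> by 1 lowers the weighted sum by
    \<open>\<alpha> i\<close> and flips the colour, hence the minus sign.\<close>
  also have "(\<Sum>x\<in>?B. colour_sign I x) = (\<Sum>x\<in>simplex_on I \<alpha> (c - \<alpha> i). - colour_sign I x)"
  proof (rule sum.reindex_bij_witness
      [where j = "\<lambda>x. x(i := x i - 1)" and i = "\<lambda>x. x(i := x i + 1)"])
    fix x assume x: "x \<in> simplex_on I \<alpha> (c - \<alpha> i)"
    then have "0 \<le> x i"
      using i by (simp add: simplex_on_def)
    then have nz: "x i + 1 \<noteq> 0"
      by linarith
    show "x(i := x i + 1) \<in> ?B"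
      "(x(i := x i + 1))(i := (x(i := x i + 1)) i - 1) = x"
      using i x
      by (simp_all add: simplex_on_def sums PiE_iff extensional_def distrib_left nz)
  next
    fix x assume x: "x \<in> ?B"
    then have "1 \<le> x i"
      using i by (force simp: simplex_on_def)
    then show "x(i := x i - 1) \<in> simplex_on I \<alpha> (c - \<alpha> i)"
      "(x(i := x i - 1))(i := (x(i := x i - 1)) i + 1) = x"
      "- colour_sign I (x(i := x i - 1)) = colour_sign I x"
      using i x
      by (auto simp: simplex_on_def colour_sign_def sums PiE_iff extensional_def
          right_diff_distrib)
  qed
  finally show ?thesis
    by (simp add: white_excess_def sum_negf)
qed

lemma white_excess_empty: "white_excess {} \<alpha> c = (if 0 \<le> c then 1 else 0)"
  by (simp add: white_excess_def simplex_on_def colour_sign_def)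

text \<open>The points 0, 1, 2, ... alternate in colour starting with white, so their signs cancel
  in pairs. The condition \<open>0 \<le> c\<close> excludes negative even floors.\<close>

lemma white_excess_singleton:
  assumes pos: "0 < \<alpha> i"
  shows "white_excess {i} \<alpha> c = (if 0 \<le> c \<and> even \<lfloor>c / \<alpha> i\<rfloor> then 1 else 0)"
proof -
  have neg: "white_excess {i} \<alpha> d = 0" if "d < 0" for d
    using simplex_on_neg[of "{i}" \<alpha> d] pos that by (simp add: white_excess_def)
  have rec: "white_excess {i} \<alpha> d = 1 - white_excess {i} \<alpha> (d - \<alpha> i)" if "0 \<le> d" for d
    using white_excess_recursion[of "{i}" \<alpha> i d] pos that by (simp add: white_excess_empty)
  have "white_excess {i} \<alpha> d = (if even n then 1 else 0)" if "\<lfloor>d / \<alpha> i\<rfloor> = int n" for d n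
    using that
  proof (induction n arbitrary: d)
    case 0
    then have "0 \<le> d" "d < \<alpha> i"
      using pos by (simp_all add: floor_eq_iff field_simps)
    then show ?case
      by (simp add: rec neg)
  next
    case (Suc n)
    have "(d - \<alpha> i) / \<alpha> i = d / \<alpha> i - 1"
      using pos by (simp add: field_simps)
    then have "white_excess {i} \<alpha> (d - \<alpha> i) = (if even n then 1 else 0)"
      using Suc.prems by (intro Suc.IH) simp
    moreover have "0 \<le> d / \<alpha> i"
      using Suc.prems by linarith
    then have "0 \<le> d"
      using pos by (simp add: zero_le_divide_iff)
    ultimately show ?case
      by (simp add: rec)
  qed
  from this[of c "nat \<lfloor>c / \<alpha> i\<rfloor>"] show ?thesis
    using pos neg[of c] by (cases "0 \<le> c") (auto simp: even_nat_iff)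
qed

text \<open>The recursion adds the coordinates in \<open>J - I\<close> one at a time. The bound may
  move from \<open>c\<close> to another \<open>d\<close>, since each step shows only that one of two
  values is negative, not which.\<close>

lemma white_excess_neg_mono:
  assumes "finite J" "I \<subseteq> J" and pos: "\<And>j. j \<in> J \<Longrightarrow> 0 < \<alpha> j"
    and neg: "white_excess I \<alpha> c < 0"
  shows "\<exists>d. white_excess J \<alpha> d < 0"
  using assms
proof (induction "J - I" arbitrary: J rule: infinite_finite_induct)
  case infinite
  then show ?case by simp
next
  case empty
  then have "J = I" by blast
  with neg show ?case by blast
next
  case (insert j K)
  then have j: "j \<in> J" "I \<subseteq> J - {j}" and K: "K = (J - {j}) - I"
    by blast+
  obtain d where "white_excess (J - {j}) \<alpha> d < 0"
    using insert.hyps(3)[OF K] insert.prems j by auto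
  then have "white_excess J \<alpha> d + white_excess J \<alpha> (d - \<alpha> j) < 0"
    using white_excess_recursion[of J \<alpha> j d] insert.prems j by simp
  then show ?case
    by (metis add_nonneg_nonneg not_less)
qed

text \<open>Put \<open>f = frac (k * \<theta>)\<close> and \<open>g = frac (\<theta> / 2)\<close>.
  Modulo 2, the two numbers are \<open>2 * f\<close> and \<open>2 * (f + g)\<close>, so
  \<open>1/2 \<le> f < 1\<close> and \<open>1 \<le> f + g < 3/2\<close> suffice.\<close>

lemma odd_even_floor_multiples:
  fixes \<theta> :: real
  assumes irr: "\<theta> \<notin> \<rat>"
  obtains k :: nat where "odd \<lfloor>2 * real k * \<theta>\<rfloor>" "even \<lfloor>(2 * real k + 1) * \<theta>\<rfloor>"
proof -
  define g where "g = frac (\<theta> / 2)"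
  have "\<theta> / 2 \<notin> \<int>"
    using irr Rats_mult[of "\<theta> / 2" 2] Ints_subset_Rats by auto
  then have g: "0 < g" "g < 1"
    by (simp_all add: g_def frac_gt_0_iff frac_lt_1)
  \<comment> \<open>The two conditions on \<open>f\<close> hold strictly between \<open>L\<close>
    and \<open>U\<close>; this interval is nonempty because \<open>0 < g < 1\<close>.\<close>
  define L where "L = max (1/2) (1 - g)"
  define U where "U = min 1 (3/2 - g)"
  have LU: "L < U"
    using g by (auto simp: L_def U_def)
  have "0 \<le> (L + U) / 2" "(L + U) / 2 \<le> 1" "0 < (U - L) / 2"
    using g LU by (auto simp: L_def U_def)
  \<comment> \<open>Kronecker's theorem with the midpoint as target and half the length as
    tolerance.\<close>
  then obtain k where k: "\<bar>frac (real k * \<theta>) - (L + U) / 2\<bar> < (U - L) / 2"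
    using Kronecker_approx_1_explicit[OF irr] by blast
  define f where "f = frac (real k * \<theta>)"
  from k have f: "L < f" "f < U"
    unfolding f_def abs_less_iff by (simp_all add: field_simps)
  have k\<theta>: "real k * \<theta> = \<lfloor>real k * \<theta>\<rfloor> + f" and \<theta>: "\<theta> = 2 * (\<lfloor>\<theta> / 2\<rfloor> + g)"
    by (simp_all add: f_def g_def frac_def)
  have "\<lfloor>2 * real k * \<theta>\<rfloor> = 2 * \<lfloor>real k * \<theta>\<rfloor> + 1"
    using k\<theta> f by (intro floor_unique) (auto simp: L_def U_def)
  moreover have "\<lfloor>(2 * real k + 1) * \<theta>\<rfloor> = 2 * (\<lfloor>real k * \<theta>\<rfloor> + \<lfloor>\<theta> / 2\<rfloor> + 1)"
    using k\<theta> \<theta> f by (intro floor_unique) (auto simp: L_def U_def distrib_right)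
  ultimately show thesis
    by (intro that[of k]) simp_all
qed

lemma white_excess_pair_neg:
  assumes pos: "0 < \<alpha> i" "0 < \<alpha> j" and irr: "\<alpha> i / \<alpha> j \<notin> \<rat>"
  shows "\<exists>c. white_excess {i, j} \<alpha> c < 0"
proof (rule ccontr)
  assume "\<not> ?thesis"
  then have nonneg: "0 \<le> white_excess {i, j} \<alpha> c" for c
    by (simp add: not_less)
  have "i \<noteq> j"
    using irr pos by auto
  then have rec_j: "white_excess {i, j} \<alpha> c + white_excess {i, j} \<alpha> (c - \<alpha> j) = white_excess {i} \<alpha> c"
    and rec_i: "white_excess {i, j} \<alpha> c + white_excess {i, j} \<alpha> (c - \<alpha> i) = white_excess {j} \<alpha> c" for c
    using white_excess_recursion[of "{i, j}" \<alpha> j c] white_excess_recursion[of "{i, j}" \<alpha> i c] pos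
    by (auto simp: insert_Diff_if)
  \<comment> \<open>By \<open>rec_j\<close> the two nonnegative values add up to
    \<open>white_excess {i} \<alpha> c\<close>, which is 0 here.\<close>
  have zero: "white_excess {i, j} \<alpha> c = 0" "white_excess {i, j} \<alpha> (c - \<alpha> j) = 0"
    if "odd \<lfloor>c / \<alpha> i\<rfloor>" for c
    using rec_j[of c] nonneg[of c] nonneg[of "c - \<alpha> j"] that pos
    by (simp_all add: white_excess_singleton)
  have "\<alpha> j / \<alpha> i \<notin> \<rat>"
    using irr Rats_inverse[of "\<alpha> j / \<alpha> i"] by auto
  then obtain k :: nat where k: "odd \<lfloor>2 * real k * (\<alpha> j / \<alpha> i)\<rfloor>"
    "even \<lfloor>(2 * real k + 1) * (\<alpha> j / \<alpha> i)\<rfloor>"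
    by (rule odd_even_floor_multiples)
  \<comment> \<open>An even multiple of \<open>\<alpha> j\<close> makes the excess for
    \<open>{j}\<close> equal to 1.\<close>
  define c where "c = 2 * real k * \<alpha> j"
  have "white_excess {i, j} \<alpha> c = 0"
    using k(1) by (intro zero) (simp add: c_def)
  moreover have "white_excess {i, j} \<alpha> (c - \<alpha> i) = 0"
  proof -
    \<comment> \<open>The shift by \<open>\<alpha> j\<close> is undone by \<open>zero(2)\<close>;
      the -1 turns the even floor into an odd one.\<close>
    have "(c - \<alpha> i + \<alpha> j) / \<alpha> i = (2 * real k + 1) * (\<alpha> j / \<alpha> i) - 1"
      using pos by (simp add: c_def field_simps)
    then have "odd \<lfloor>(c - \<alpha> i + \<alpha> j) / \<alpha> i\<rfloor>"
      using k(2) by simp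
    from zero(2)[OF this] show ?thesis by simp
  qed
  moreover have "white_excess {j} \<alpha> c = 1"
  proof -
    have "c / \<alpha> j = of_int (2 * int k)"
      using pos by (simp add: c_def)
    then have "\<lfloor>c / \<alpha> j\<rfloor> = 2 * int k"
      by (simp only: floor_of_int)
    then show ?thesis
      using pos by (simp add: white_excess_singleton c_def)
  qed
  ultimately show False
    using rec_i[of c] by simp
qed

text \<open>For \<open>c \<le> 0\<close> the simplex contains at most the origin, which is white.
  Hence a bound with negative excess is positive, as the theorem demands.\<close>

lemma white_excess_nonneg:
  assumes pos: "\<And>i. i \<in> I \<Longrightarrow> 0 < \<alpha> i" and fin: "finite I" and c: "c \<le> 0"
  shows "0 \<le> white_excess I \<alpha> c"
  unfolding white_excess_def
proof (rule sum_nonneg)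
  fix x assume x: "x \<in> simplex_on I \<alpha> c"
  have nonneg: "0 \<le> \<alpha> i * real_of_int (x i)" if "i \<in> I" for i
    using x pos[OF that] that by (simp add: simplex_on_def)
  then have "(\<Sum>i\<in>I. \<alpha> i * real_of_int (x i)) = 0"
    using x c sum_nonneg[of I "\<lambda>i. \<alpha> i * real_of_int (x i)"] by (force simp: simplex_on_def)
  then have "\<forall>i\<in>I. \<alpha> i * real_of_int (x i) = 0"
    using sum_nonneg_eq_0_iff[of I "\<lambda>i. \<alpha> i * real_of_int (x i)"] fin nonneg by simp
  then have "\<forall>i\<in>I. x i = 0"
    using pos by fastforce
  then show "0 \<le> colour_sign I x"
    by (simp add: colour_sign_def)
qed

text \<open>Each sign is the difference of the indicators of white and black.\<close>

lemma white_excess_eq_card: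
  assumes pos: "\<And>i. i \<in> {1..r} \<Longrightarrow> 0 < \<alpha> i"
  shows "white_excess {1..r} \<alpha> c =
    int (card {x \<in> simplex_points r \<alpha> c. white r x}) -
    int (card {x \<in> simplex_points r \<alpha> c. black r x})"
proof -
  let ?S = "simplex_points r \<alpha> c"
  have fin: "finite ?S"
    using pos by (rule finite_simplex_points)
  have S: "simplex_on {1..r} \<alpha> c = ?S"
    by (simp add: simplex_on_def simplex_points_def lattice_points_def)
  have "white_excess {1..r} \<alpha> c = (\<Sum>x\<in>?S. of_bool (white r x) - of_bool (black r x))"
    unfolding white_excess_def S
    by (intro sum.cong) (auto simp: colour_sign_def white_def black_def)
  also have "\<dots> = int (card {x \<in> ?S. white r x}) - int (card {x \<in> ?S. black r x})"
    using fin by (simp add: sum_subtractf Int_def)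
  finally show ?thesis .
qed

theorem theorem8:
  fixes r :: nat and \<alpha> :: "nat \<Rightarrow> real"
  assumes "r \<ge> 2"
    and "0 < \<alpha> 1"
    and "strict_mono_on {1..r} \<alpha>"
    and "\<alpha> 1 / \<alpha> 2 \<notin> \<rat>"
  shows "\<exists>c>0. card {x \<in> simplex_points r \<alpha> c. black r x} > card {x \<in> simplex_points r \<alpha> c. white r x}"
proof -
  have pos: "0 < \<alpha> i" if "i \<in> {1..r}" for i
  proof (cases "i = 1")
    case False
    then have "\<alpha> 1 < \<alpha> i"
      using that by (intro strict_mono_onD[OF assms(3)]) auto
    with assms(2) show ?thesis by simp
  qed (use assms(2) in simp)
  obtain c where "white_excess {1, 2} \<alpha> c < 0"
    using white_excess_pair_neg[of \<alpha> 1 2] pos assms by auto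
  then obtain d where d: "white_excess {1..r} \<alpha> d < 0"
    using white_excess_neg_mono[of "{1..r}" "{1, 2}" \<alpha> c] pos assms(1) by auto
  then have "0 < d"
    using white_excess_nonneg[of "{1..r}" \<alpha> d] pos by force
  with d white_excess_eq_card[of r \<alpha> d] pos show ?thesis
    by (intro exI[of _ d]) auto
qed

end
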